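(* Let $D_{11}>0$, $v_0\in\mathbb{R}$, and $c_a^0,c_p^0\in\mathbb{R}$. For $x>0$ and $t>0$ let $$c_\infty(x,t)=c_a^0-\big(c_a^0-c_p^0\big)\int_0^t\frac{x}{2\sqrt{\pi D_{11}\tau^3}}\,e^{-\frac{(x-v_0\tau)^2}{4D_{11}\tau}}\,d\tau .$$ Then $$c_\infty(x,t)=c_a^0-\frac{c_a^0-c_p^0}{2}\left[e^{\frac{v_0x}{D_{11}}}\,\mathrm{erfc}\left(\frac{x+v_0t}{2\sqrt{D_{11}t}}\right)+\mathrm{erfc}\left(\frac{x-v_0t}{2\sqrt{D_{11}t}}\right)\right].$$ In particular, if $c_a^0=0$, $$c_\infty(x,t)=\frac{c_p^0}{2}\left[e^{\frac{v_0x}{D_{11}}}\,\mathrm{erfc}\left(\frac{x+v_0t}{2\sqrt{D_{11}t}}\right)+\mathrm{erfc}\left(\frac{x-v_0t}{2\sqrt{D_{11}t}}\right)\right].$$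
   Context: $\mathrm{erfc}(z)=\frac{2}{\sqrt{\pi}}\int_z^\infty e^{-u^2}\,du$ is the complementary error function. The function $c_\infty$ is the half-space ($L\to\infty$) solution of $\partial_tc+v_0\partial_xc-D_{11}\partial_x^2c=0$ with constant initial value $c_a^0$ and constant boundary value $c_p^0$ at $x=0$. *)

theory Defs
  imports "HOL-Analysis.Analysis"
begin

definition erfc :: "real \<Rightarrow> real" where
  "erfc z = 2 / sqrt pi * integral {z..} (\<lambda>u. exp (- (u\<^sup>2)))"

text \<open>
  The library's division convention gives the integrand the value \<open>0\<close> at the endpoint \<open>\<tau> = 0\<close>,
  a null set that does not affect the integral.
\<close>

definition c_inf :: "real \<Rightarrow> real \<Rightarrow> real \<Rightarrow> real \<Rightarrow> real \<Rightarrow> real \<Rightarrow> real" where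
  "c_inf D11 v0 ca0 cp0 x t =
     ca0 - (ca0 - cp0) *
       integral {0..t} (\<lambda>\<tau>. x / (2 * sqrt (pi * D11 * \<tau> ^ 3))
                              * exp (- ((x - v0 * \<tau>)\<^sup>2 / (4 * D11 * \<tau>))))"

end

theory Submission
  imports Defs "HOL-Real_Asymp.Real_Asymp"
begin

text \<open>
  Half of the bracket is an antiderivative of the integrand: the squares of the two arguments of
  \<open>erfc\<close> differ by \<open>v0 * x / D11\<close>, so both terms carry the same Gaussian factor, and the sum of the
  arguments is \<open>x / sqrt (D11 * \<tau>)\<close>. Both arguments tend to infinity as \<open>\<tau>\<close> tends to \<open>0\<close>, so this
  antiderivative extends continuously by \<open>0\<close>. Only \<open>erfc'\<close> and the limit of \<open>erfc\<close> at infinity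
  matter; the value of the Gaussian integral plays no role.
\<close>

text \<open>Completing the square fixes the constant \<open>1/4\<close>. This exponential majorant
  holds on the whole line and serves twice: for integrability on every half-line, and for the decay
  of \<open>erfc\<close>.\<close>

lemma gaussian_le_exp: "exp (- (u\<^sup>2)) \<le> exp (1/4) * exp (- u)" for u :: real
proof -
  have "0 \<le> (u - 1/2)\<^sup>2" by simp
  then have "- (u\<^sup>2) \<le> 1/4 - u" by (simp add: power2_eq_square algebra_simps)
  then show ?thesis by (simp flip: exp_add)
qed

lemma exp_minus_has_integral_atLeast:
  "((\<lambda>u::real. exp (1/4) * exp (- u)) has_integral exp (1/4) * exp (- z)) {z..}"
  using has_integral_mult_right[OF has_integral_exp_minus_to_infinity[of 1 z]] by simp

lemma gaussian_integrable_atLeast: "(\<lambda>u::real. exp (- (u\<^sup>2))) integrable_on {z..}"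
proof (rule measurable_bounded_by_integrable_imp_integrable)
  show "(\<lambda>u::real. exp (- (u\<^sup>2))) \<in> borel_measurable (lebesgue_on {z..})"
    by (intro continuous_imp_measurable_on_sets_lebesgue continuous_intros) auto
  show "(\<lambda>u::real. exp (1/4) * exp (- u)) integrable_on {z..}"
    using exp_minus_has_integral_atLeast by blast
qed (use gaussian_le_exp in auto)

text \<open>Integrating the exponential majorant over \<open>{z..}\<close> squeezes
  \<open>erfc z\<close> between \<open>0\<close> and a constant multiple of
  \<open>exp (- z)\<close>.\<close>

lemma erfc_tendsto_0: "(erfc \<longlongrightarrow> 0) at_top"
proof (rule tendsto_sandwich)
  show "\<forall>\<^sub>F z in at_top. 0 \<le> erfc z"
    unfolding erfc_def
    by (intro always_eventually allI mult_nonneg_nonneg integral_nonneg gaussian_integrable_atLeast) auto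
  have "integral {z..} (\<lambda>u::real. exp (- (u\<^sup>2))) \<le> exp (1/4) * exp (- z)" for z
    using has_integral_le[OF integrable_integral[OF gaussian_integrable_atLeast]
        exp_minus_has_integral_atLeast gaussian_le_exp] .
  then show "\<forall>\<^sub>F z in at_top. erfc z \<le> 2 / sqrt pi * (exp (1/4) * exp (- z))"
    unfolding erfc_def by (intro always_eventually allI mult_left_mono) auto
  show "((\<lambda>z::real. 2 / sqrt pi * (exp (1/4) * exp (- z))) \<longlongrightarrow> 0) at_top"
    by real_asymp
qed simp

text \<open>Near \<open>z\<close> the half-line integral is a constant minus an integral with moving
  upper limit, which reduces the claim to the fundamental theorem on a compact interval. The base
  point \<open>z - 1\<close> keeps \<open>z\<close> in the interior.\<close>

lemma has_real_derivative_erfc: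
  "(erfc has_real_derivative - (2 / sqrt pi * exp (- (z\<^sup>2)))) (at z)"
proof -
  let ?f = "\<lambda>u::real. exp (- (u\<^sup>2))"
  let ?G = "\<lambda>y. 2 / sqrt pi * (integral {z - 1..} ?f - integral {z - 1..y} ?f)"
  have "((\<lambda>y. integral {z - 1..y} ?f) has_real_derivative ?f z) (at z within {z - 1..z + 1})"
    by (intro integral_has_real_derivative continuous_intros) auto
  then have "((\<lambda>y. integral {z - 1..y} ?f) has_real_derivative ?f z) (at z)"
    by (subst (asm) at_within_Icc_at) auto
  then have G: "(?G has_real_derivative - (2 / sqrt pi * ?f z)) (at z)"
    using DERIV_cmult[OF DERIV_diff[OF DERIV_const]] by (fastforce simp only: diff_0 mult_minus_right)
  have erfc_eq: "?G y = erfc y" if "z - 1 < y" for y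
  proof -
    have "integral ({z - 1..y} \<union> {y..}) ?f = integral {z - 1..y} ?f + integral {y..} ?f"
    proof (rule integral_Un)
      show "negligible ({z - 1..y} \<inter> {y..})"
        by (rule negligible_subset[of "{y}"]) auto
      show "?f integrable_on {z - 1..y}"
        by (intro integrable_continuous_real continuous_intros)
    qed (rule gaussian_integrable_atLeast)
    moreover have "{z - 1..y} \<union> {y..} = {z - 1..}" using that by auto
    ultimately show ?thesis by (simp add: erfc_def)
  qed
  show ?thesis
    by (rule has_field_derivative_transform_within_open[OF G, where S = "{z - 1<..}"])
      (use erfc_eq in auto)
qed

text \<open>The numerator tends to \<open>x > 0\<close> and the denominator to \<open>0\<close> from
  above, whatever the sign of \<open>v\<close>; hence the result covers both \<open>v\<close> and
  \<open>- v\<close>.\<close>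

lemma tendsto_erfc_argument:
  fixes D v x :: real
  assumes "D > 0" "x > 0"
  shows "((\<lambda>s. erfc ((x + v * s) / (2 * sqrt (D * s)))) \<longlongrightarrow> 0) (at_right 0)"
proof (rule filterlim_compose[OF erfc_tendsto_0])
  show "LIM s at_right 0. (x + v * s) / (2 * sqrt (D * s)) :> at_top"
    using assms by real_asymp
qed

lemma has_real_derivative_erfc_argument:
  fixes D v x s :: real
  assumes "D > 0" "s > 0"
  shows "((\<lambda>s. erfc ((x + v * s) / (2 * sqrt (D * s)))) has_real_derivative
           (x - v * s) / (2 * s * sqrt (pi * D * s)) * exp (- ((x + v * s)\<^sup>2 / (4 * D * s)))) (at s)"
proof -
  define r where "r = sqrt (D * s)"
  have r: "r > 0" "r * r = D * s" using assms by (auto simp: r_def)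
  have "((\<lambda>s. (x + v * s) / (2 * sqrt (D * s))) has_real_derivative
          (v * (2 * r) - (x + v * s) * (D / r)) / (2 * r)\<^sup>2) (at s)"
    using assms r unfolding r_def
    by (auto intro!: derivative_eq_intros simp: power2_eq_square field_simps mult_less_0_iff)
  \<comment> \<open>Since \<open>r * r = D * s\<close>, the quotient rule flips the sign of the
    drift: \<open>x + v * s\<close> in the argument becomes \<open>x - v * s\<close> in its
    derivative.\<close>
  moreover have "(v * (2 * r) - (x + v * s) * (D / r)) / (2 * r)\<^sup>2 = - (x - v * s) / (4 * s * r)"
  proof -
    have "v * (2 * r) - (x + v * s) * (D / r) = - (x - v * s) * D / r"
      using r by (simp add: field_simps)
    moreover have "(2 * r)\<^sup>2 = 4 * (D * s)"
      using r by (simp add: power2_eq_square)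
    ultimately show ?thesis using assms r by (simp add: field_simps)
  qed
  ultimately have "((\<lambda>s. (x + v * s) / (2 * sqrt (D * s))) has_real_derivative
      - (x - v * s) / (4 * s * r)) (at s)" by simp
  note chain = DERIV_chain2[OF has_real_derivative_erfc this]
  have sq: "((x + v * s) / (2 * sqrt (D * s)))\<^sup>2 = (x + v * s)\<^sup>2 / (4 * D * s)"
    using assms by (simp add: power_divide power_mult_distrib)
  have root: "sqrt (pi * D * s) = sqrt pi * r"
    by (simp add: r_def real_sqrt_mult)
  have eq: "- (2 / sqrt pi * e) * (- (x - v * s) / (4 * s * r))
      = (x - v * s) / (2 * s * (sqrt pi * r)) * e" for e
    using assms r(1) by (simp add: divide_simps) (simp add: algebra_simps)
  show ?thesis
    using chain unfolding sq root eq .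
qed

text \<open>The integrand is the density of the first time at which a Brownian motion with drift
  \<open>v\<close> and diffusivity \<open>D\<close>, started at \<open>0\<close>, reaches
  \<open>x\<close>.\<close>

lemma first_passage_has_integral:
  fixes D v x t :: real
  assumes D: "D > 0" and x: "x > 0" and t: "t > 0"
  shows "((\<lambda>\<tau>. x / (2 * sqrt (pi * D * \<tau> ^ 3)) * exp (- ((x - v * \<tau>)\<^sup>2 / (4 * D * \<tau>))))
          has_integral (exp (v * x / D) * erfc ((x + v * t) / (2 * sqrt (D * t)))
                        + erfc ((x - v * t) / (2 * sqrt (D * t)))) / 2) {0..t}"
proof -
  define E where "E = (\<lambda>w s. erfc ((x + w * s) / (2 * sqrt (D * s))))"
  define H where "H = (\<lambda>s. (exp (v * x / D) * E v s + E (- v) s) / 2)"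
  \<comment> \<open>Division by zero makes both arguments \<open>0\<close> at \<open>s = 0\<close>,
    so \<open>H 0\<close> is a positive multiple of \<open>erfc 0\<close> instead of the limit
    \<open>0\<close>; \<open>F\<close> repairs this value.\<close>
  define F where "F = (\<lambda>s. if s = 0 then 0 else H s)"
  let ?f = "\<lambda>\<tau>. x / (2 * sqrt (pi * D * \<tau> ^ 3)) * exp (- ((x - v * \<tau>)\<^sup>2 / (4 * D * \<tau>)))"
  have deriv: "(F has_real_derivative ?f s) (at s)" if s: "s > 0" for s
  proof -
    define e where "e = exp (- ((x - v * s)\<^sup>2 / (4 * D * s)))"
    define q where "q = sqrt (pi * D * s)"
    have q: "q > 0" using D s by (simp add: q_def)
    have "v * x / D + - ((x + v * s)\<^sup>2 / (4 * D * s)) = - ((x - v * s)\<^sup>2 / (4 * D * s))"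
      using D s by (simp add: field_simps power2_eq_square)
    then have same: "exp (v * x / D) * exp (- ((x + v * s)\<^sup>2 / (4 * D * s))) = e"
      unfolding e_def by (simp flip: exp_add)
    have "sqrt (pi * D * s ^ 3) = sqrt ((pi * D * s) * s\<^sup>2)"
      by (simp add: power3_eq_cube power2_eq_square mult_ac)
    also have "\<dots> = q * s" using s by (simp add: q_def real_sqrt_mult)
    finally have root: "sqrt (pi * D * s ^ 3) = q * s" .
    have Ev: "(E v has_real_derivative
        (x - v * s) / (2 * s * q) * exp (- ((x + v * s)\<^sup>2 / (4 * D * s)))) (at s)"
      unfolding E_def q_def using has_real_derivative_erfc_argument[OF D s, of x v] .
    have Em: "(E (- v) has_real_derivative (x + v * s) / (2 * s * q) * e) (at s)"
      unfolding E_def q_def e_def using has_real_derivative_erfc_argument[OF D s, of x "- v"] by simp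
    have "(H has_real_derivative (exp (v * x / D) *
        ((x - v * s) / (2 * s * q) * exp (- ((x + v * s)\<^sup>2 / (4 * D * s))))
          + (x + v * s) / (2 * s * q) * e) / 2) (at s)"
      unfolding H_def by (intro DERIV_cdivide DERIV_add DERIV_cmult Ev Em)
    also have "exp (v * x / D) * ((x - v * s) / (2 * s * q) * exp (- ((x + v * s)\<^sup>2 / (4 * D * s))))
        = (x - v * s) / (2 * s * q) * e"
      by (simp flip: same)
    \<comment> \<open>The drift cancels in \<open>(x - v * s) + (x + v * s) = 2 * x\<close>, and
      \<open>q * s\<close> is the root in the integrand.\<close>
    also have "((x - v * s) / (2 * s * q) * e + (x + v * s) / (2 * s * q) * e) / 2 = ?f s"
      unfolding root e_def[symmetric] using s q by (simp add: field_simps)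
    finally show ?thesis
      by (rule has_field_derivative_transform_within_open[where S = "{0<..}"])
        (use s in \<open>auto simp: F_def\<close>)
  qed
  have E0: "(E w \<longlongrightarrow> 0) (at_right 0)" for w
    unfolding E_def by (rule tendsto_erfc_argument[OF D x])
  have "(H \<longlongrightarrow> (exp (v * x / D) * 0 + 0) / 2) (at_right 0)"
    unfolding H_def by (intro tendsto_intros E0) simp
  then have "(H \<longlongrightarrow> F 0) (at_right 0)" by (simp add: F_def)
  then have F0: "(F \<longlongrightarrow> F 0) (at_right 0)"
    by (rule Lim_transform_eventually) (auto simp: F_def eventually_at_filter)
  have "continuous_on {0..t} F"
    unfolding continuous_on_eq_continuous_within
  proof
    fix s assume "s \<in> {0..t}"
    show "continuous (at s within {0..t}) F"
    proof (cases "s = 0")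
      case True
      then show ?thesis using F0 t by (simp add: continuous_within at_within_Icc_at_right)
    next
      case False
      with \<open>s \<in> {0..t}\<close> have "s > 0" by simp
      then show ?thesis
        using deriv DERIV_isCont continuous_at_imp_continuous_at_within by blast
    qed
  qed
  \<comment> \<open>The interior form of the theorem combines derivatives on the open interval with
    continuity up to \<open>0\<close>, and yields integrability of the integrand as well.\<close>
  then have "(?f has_integral (F t - F 0)) {0..t}"
    using t deriv
    by (intro fundamental_theorem_of_calculus_interior)
      (auto simp flip: has_real_derivative_iff_has_vector_derivative)
  then show ?thesis using t by (simp add: F_def H_def E_def)
qed

theorem mainTheorem4:
  fixes D11 v0 ca0 cp0 x t :: real
  assumes "D11 > 0" and "x > 0" and "t > 0"
  shows "c_inf D11 v0 ca0 cp0 x t =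
           ca0 - (ca0 - cp0) / 2 *
             (exp (v0 * x / D11) * erfc ((x + v0 * t) / (2 * sqrt (D11 * t)))
              + erfc ((x - v0 * t) / (2 * sqrt (D11 * t))))
         \<and> (ca0 = 0 \<longrightarrow>
             c_inf D11 v0 ca0 cp0 x t =
               cp0 / 2 *
                 (exp (v0 * x / D11) * erfc ((x + v0 * t) / (2 * sqrt (D11 * t)))
                  + erfc ((x - v0 * t) / (2 * sqrt (D11 * t)))))"
  unfolding c_inf_def integral_unique[OF first_passage_has_integral[OF assms]] by simp

end
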